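(* Let $d\in\mathbb N$, $a\in\mathbb N_0$. For all integers $n\ge m\ge 0$, $$S2(d,a;n,m)=\frac{1}{m!}\sum_{k=0}^m(-1)^{m-k}\binom{m}{k}(a+d\,k)^n.$$
   Context: $\mathbb N=\{1,2,\dots\}$, $\mathbb N_0=\{0,1,2,\dots\}$, $0^0:=1$. The numbers $S2(d,a;n,m)$, $0\le m\le n$, are defined by the operator identity $(a\,\mathbf 1+d\,\mathbf E_x)^n=\sum_{m=0}^n S2(d,a;n,m)\,x^m\,\mathbf d_x^{\,m}$, where $\mathbf d_x$ is differentiation with respect to $x$, $\mathbf E_x:=x\,\mathbf d_x$ and $\mathbf 1$ is the identity operator. *)

theory Defs
  imports Complex_Main "HOL-Computational_Algebra.Formal_Power_Series"
begin

text \<open>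
  Differential operators act on formal power series in \<open>x\<close>, with \<^const>\<open>fps_deriv\<close>
  as differentiation.
\<close>

definition euler_op :: "real fps \<Rightarrow> real fps" where
  "euler_op f = fps_X * fps_deriv f"

definition affine_euler_op :: "nat \<Rightarrow> nat \<Rightarrow> real fps \<Rightarrow> real fps" where
  "affine_euler_op d a f = of_nat a * f + of_nat d * euler_op f"

text \<open>
  The operator identity only constrains the coefficients with \<open>m \<le> n\<close>; the remaining
  ones are set to zero so that the description can be unique.
\<close>

definition S2 :: "nat \<Rightarrow> nat \<Rightarrow> nat \<Rightarrow> nat \<Rightarrow> real" where
  "S2 d a n = (THE c. (\<forall>m>n. c m = 0) \<and>
     affine_euler_op d a ^^ n =
       (\<lambda>f. \<Sum>m=0..n. fps_const (c m) * (fps_X ^ m * (fps_deriv ^^ m) f)))"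

end

(* Both sides of the operator identity act diagonally on the coefficient of x^j: the left-hand
   side by (a + d j)^n, and x^m D^m by the falling factorial m! (j choose m). The identity
   therefore says that m! S2(n,m) are the Newton coefficients of j |-> (a + d j)^n, which
   binomial inversion recovers. Such coefficients exist by induction on n, because
   (j - m) (j choose m) = (m + 1) (j choose (m + 1)). *)
theory Submission
  imports Defs
begin

unbundle fps_syntax

text \<open>Absorption of binomial coefficients. The difference is taken in the reals, so the case
  \<open>j < m\<close> is covered too: both binomials vanish there.\<close>

lemma minus_mult_binomial:
  "(real j - real m) * real (j choose m) = real (Suc m) * real (j choose Suc m)"
proof (cases "m \<le> j")
  case True
  have "(j - m) * (j choose m) = Suc m * (j choose Suc m)"
    by (metis binomial_absorb_comp binomial_absorption)
  then have "real ((j - m) * (j choose m)) = real (Suc m * (j choose Suc m))"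
    by simp
  then show ?thesis
    using True by (simp only: of_nat_mult of_nat_diff)
qed (simp add: binomial_eq_0)

text \<open>By the product rule, x^(m+1) D^(m+1) = (x D - m) x^m D^m, and x D - m multiplies the
  coefficient of x^j by j - m.\<close>

lemma fps_X_power_mult_higher_deriv_nth:
  fixes f :: "real fps"
  shows "(fps_X ^ m * (fps_deriv ^^ m) f) $ j = fact m * real (j choose m) * f $ j"
proof (induction m)
  case (Suc m)
  let ?g = "fps_X ^ m * (fps_deriv ^^ m) f"
  have "fps_X * fps_deriv (fps_X ^ m) = (of_nat m * fps_X ^ m :: real fps)"
    by (induction m) (simp_all add: algebra_simps)
  then have "fps_X * fps_deriv ?g = of_nat m * ?g + fps_X ^ Suc m * (fps_deriv ^^ Suc m) f"
    by (simp add: distrib_left mult.assoc[symmetric])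
  then have "fps_X ^ Suc m * (fps_deriv ^^ Suc m) f = fps_X * fps_deriv ?g - of_nat m * ?g"
    by simp
  moreover have "(fps_X * fps_deriv g - of_nat m * g) $ j = (real j - real m) * g $ j"
    for g :: "real fps"
    by (cases j) (simp_all add: fps_of_nat[symmetric] algebra_simps)
  ultimately have "(fps_X ^ Suc m * (fps_deriv ^^ Suc m) f) $ j = (real j - real m) * ?g $ j"
    by (simp only:)
  also have "\<dots> = fact m * ((real j - real m) * real (j choose m)) * f $ j"
    by (simp add: Suc.IH)
  also have "\<dots> = fact (Suc m) * real (j choose Suc m) * f $ j"
    by (simp only: minus_mult_binomial fact_Suc) (simp add: algebra_simps)
  finally show ?case .
qed simp

lemma affine_euler_op_power_nth:
  "(affine_euler_op d a ^^ n) f $ j = real (a + d * j) ^ n * f $ j"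
proof (induction n)
  case (Suc n)
  have "affine_euler_op d a g $ j = real (a + d * j) * g $ j" for g
    unfolding affine_euler_op_def euler_op_def
    by (cases j) (simp_all add: fps_of_nat[symmetric] algebra_simps)
  then show ?case
    by (simp add: Suc.IH)
qed simp

lemma affine_euler_op_power_eq_iff:
  "affine_euler_op d a ^^ n =
     (\<lambda>f. \<Sum>m=0..n. fps_const (c m) * (fps_X ^ m * (fps_deriv ^^ m) f)) \<longleftrightarrow>
   (\<forall>j. real (a + d * j) ^ n = (\<Sum>m=0..n. c m * fact m * real (j choose m)))"
  (is "?L = ?R \<longleftrightarrow> _")
proof -
  have R: "?R f $ j = (\<Sum>m=0..n. c m * fact m * real (j choose m)) * f $ j" for f j
    by (simp add: fps_sum_nth fps_X_power_mult_higher_deriv_nth sum_distrib_right mult.assoc)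
  show ?thesis
  proof
    assume eq: "?L = ?R"
    show "\<forall>j. real (a + d * j) ^ n = (\<Sum>m=0..n. c m * fact m * real (j choose m))"
    proof
      fix j
      \<comment> \<open>The series with all coefficients 1 tests every \<open>j\<close> at once: the
        common factor \<open>f $ j\<close> becomes 1.\<close>
      have "?L (Abs_fps (\<lambda>_. 1)) $ j = ?R (Abs_fps (\<lambda>_. 1)) $ j"
        by (simp only: eq)
      then show "real (a + d * j) ^ n = (\<Sum>m=0..n. c m * fact m * real (j choose m))"
        by (simp only: R affine_euler_op_power_nth) simp
    qed
  next
    assume "\<forall>j. real (a + d * j) ^ n = (\<Sum>m=0..n. c m * fact m * real (j choose m))"
    then show "?L = ?R"
      by (intro ext fps_ext) (simp only: R affine_euler_op_power_nth)
  qed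
qed

lemma affine_power_binomial_expansion:
  "\<exists>c. (\<forall>m>n. c m = 0) \<and>
     (\<forall>j. real (a + d * j) ^ n = (\<Sum>m=0..n. c m * fact m * real (j choose m)))"
proof (induction n)
  case 0
  show ?case
    by (rule exI[of _ "\<lambda>m. if m = 0 then 1 else 0"]) simp
next
  case (Suc n)
  then obtain c where c0: "\<And>m. m > n \<Longrightarrow> c m = 0"
    and c: "\<And>j. real (a + d * j) ^ n = (\<Sum>m=0..n. c m * fact m * real (j choose m))"
    by blast
  \<comment> \<open>The triangular recurrence, from a + d j = (a + d m) + d (j - m): the first part
    keeps the index \<open>m\<close>, the second raises it by one. The value 0 at
    \<open>m = 0\<close> stands for the missing c(-1).\<close>
  define b where "b m = real (a + d * m) * c m + (case m of 0 \<Rightarrow> 0 | Suc k \<Rightarrow> real d * c k)" for m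
  have "real (a + d * j) ^ Suc n = (\<Sum>m=0..Suc n. b m * fact m * real (j choose m))" for j
  proof -
    let ?t = "\<lambda>m. fact m * real (j choose m)"
    have step: "real (a + d * j) * ?t m = real (a + d * m) * ?t m + real d * ?t (Suc m)" for m
    proof -
      have "real (a + d * j) * ?t m =
          real (a + d * m) * ?t m + real d * fact m * ((real j - real m) * real (j choose m))"
        by (simp add: algebra_simps)
      also have "\<dots> = real (a + d * m) * ?t m + real d * ?t (Suc m)"
        by (simp only: minus_mult_binomial fact_Suc) (simp add: algebra_simps)
      finally show ?thesis .
    qed
    have "real (a + d * j) ^ Suc n = (\<Sum>m=0..n. c m * (real (a + d * j) * ?t m))"
      by (simp only: power_Suc c sum_distrib_left) (simp add: algebra_simps)
    also have "\<dots> = (\<Sum>m=0..n. real (a + d * m) * c m * ?t m) +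
        (\<Sum>m=0..n. real d * c m * ?t (Suc m))"
      by (simp only: step sum.distrib[symmetric]) (simp add: algebra_simps)
    \<comment> \<open>The added top term vanishes because \<open>c (Suc n) = 0\<close>; this is
      where the induction uses the vanishing clause.\<close>
    also have "(\<Sum>m=0..n. real (a + d * m) * c m * ?t m) =
        (\<Sum>m=0..Suc n. real (a + d * m) * c m * ?t m)"
      by (simp add: c0)
    also have "(\<Sum>m=0..n. real d * c m * ?t (Suc m)) =
        (\<Sum>m=0..Suc n. (case m of 0 \<Rightarrow> 0 | Suc k \<Rightarrow> real d * c k) * ?t m)"
      by (simp only: sum.atLeast0_atMost_Suc_shift) simp
    finally show ?thesis
      by (simp only: b_def sum.distrib[symmetric] distrib_right mult.assoc)
  qed
  moreover have "b m = 0" if "m > Suc n" for m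
    using that by (auto simp: b_def c0 split: nat.split)
  ultimately show ?case
    by blast
qed

text \<open>Trinomial revision pulls out (m choose i) and leaves the binomial expansion of (1 -
  1)^(m-i), which is nonzero only for \<open>i = m\<close>, where 0^0 = 1.\<close>

lemma alternating_sum_binomial_mult:
  "(\<Sum>k=0..m. (-1) ^ (m - k) * real (m choose k) * real (k choose i)) = (if i = m then 1 else 0)"
proof (cases "i \<le> m")
  case False
  then show ?thesis
    by (auto intro!: sum.neutral)
next
  case True
  have "(\<Sum>k=0..m. (-1) ^ (m - k) * real (m choose k) * real (k choose i)) =
      (\<Sum>k=i..m. (-1) ^ (m - k) * real (m choose k) * real (k choose i))"
    by (rule sum.mono_neutral_right) auto
  also have "\<dots> = (\<Sum>k=i..m. (-1) ^ (m - k) * (real (m choose i) * real ((m - i) choose (k - i))))"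
    by (intro sum.cong refl) (simp add: choose_mult mult.assoc flip: of_nat_mult)
  also have "\<dots> = (\<Sum>k=0..m-i. (-1) ^ (m - i - k) * (real (m choose i) * real ((m - i) choose k)))"
    by (rule sum.reindex_bij_witness[of _ "\<lambda>k. k + i" "\<lambda>k. k - i"]) (use True in auto)
  also have "\<dots> = real (m choose i) * (1 + (-1)) ^ (m - i)"
    by (simp only: binomial_ring sum_distrib_left atLeast0AtMost) (simp add: algebra_simps)
  finally show ?thesis
    using True by auto
qed

text \<open>After exchanging the sums, the orthogonality relation above selects the single index
  \<open>i = m\<close>, which lies in the range since \<open>m \<le> n\<close>.\<close>

lemma binomial_inversion:
  fixes b g :: "nat \<Rightarrow> real"
  assumes "m \<le> n" and "\<And>j. g j = (\<Sum>i=0..n. b i * real (j choose i))"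
  shows "(\<Sum>k=0..m. (-1) ^ (m - k) * real (m choose k) * g k) = b m"
proof -
  have "(\<Sum>k=0..m. (-1) ^ (m - k) * real (m choose k) * g k) =
      (\<Sum>k=0..m. \<Sum>i=0..n. b i * ((-1) ^ (m - k) * real (m choose k) * real (k choose i)))"
    by (simp only: assms(2) sum_distrib_left) (simp only: ac_simps)
  also have "\<dots> = (\<Sum>i=0..n. b i * (\<Sum>k=0..m. (-1) ^ (m - k) * real (m choose k) * real (k choose i)))"
    by (subst sum.swap) (simp only: sum_distrib_left)
  also have "\<dots> = b m"
    using assms(1) by (simp add: alternating_sum_binomial_mult if_distrib cong: if_cong)
  finally show ?thesis .
qed

theorem mainTheorem5:
  fixes d a n m :: nat
  assumes "d \<ge> 1" and "m \<le> n"
  shows "S2 d a n m =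
    1 / fact m * (\<Sum>k=0..m. (-1) ^ (m - k) * real (m choose k) * real (a + d * k) ^ n)"
proof -
  \<comment> \<open>The condition under \<open>THE\<close> in \<open>S2_def\<close>, with the
    operator identity replaced by its scalar form.\<close>
  define P where "P c \<longleftrightarrow> (\<forall>m>n. c m = 0) \<and>
    (\<forall>j. real (a + d * j) ^ n = (\<Sum>m=0..n. c m * fact m * real (j choose m)))" for c
  \<comment> \<open>Serves twice: it forces any two solutions to agree up to \<open>n\<close>, which
    makes the description unique, and it is the claimed formula.\<close>
  have coeff: "c m = 1 / fact m * (\<Sum>k=0..m. (-1) ^ (m - k) * real (m choose k) * real (a + d * k) ^ n)"
    if "P c" "m \<le> n" for c m
  proof -
    have "(\<Sum>k=0..m. (-1) ^ (m - k) * real (m choose k) * real (a + d * k) ^ n) = c m * fact m"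
      using that by (intro binomial_inversion[of m n _ "\<lambda>i. c i * fact i"]) (auto simp only: P_def)
    then show ?thesis
      by simp
  qed
  obtain c where "P c"
    using affine_power_binomial_expansion[of n a d] unfolding P_def by blast
  have "c' = c" if "P c'" for c'
  proof
    fix m
    show "c' m = c m"
    proof (cases "m \<le> n")
      case True
      then show ?thesis
        by (simp only: coeff[OF that] coeff[OF \<open>P c\<close>])
    next
      case False
      with that \<open>P c\<close> show ?thesis
        unfolding P_def by (metis not_le)
    qed
  qed
  then have "(THE c. P c) = c"
    using \<open>P c\<close> by blast
  then have "S2 d a n = c"
    by (simp only: S2_def affine_euler_op_power_eq_iff P_def)
  then show ?thesis
    using coeff[OF \<open>P c\<close> assms(2)] by (simp only:)
qed

end
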